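(* Let $n$ be an even positive integer, $0\le k\le n-1$, and let $\xi=a_1a_2\cdots a_{n-1}n$ be a parity alternating permutation of $[n]$ with exactly $k$ ascents whose last entry is $n$. Let $d$ be a positive integer. Then the period of $\xi$ under $\tau$ equals $d$ if and only if the period of $\xi$ under $\sigma$ equals $d(n-k)$.
   Context: Permutations of $[n]=\{1,\dots,n\}$ are written in one-line notation $a_1\cdots a_n$. It is parity alternating if $a_i,a_{i+1}$ have different parities for all $1\le i\le n-1$; an ascent is an index $i$ with $a_i<a_{i+1}$. The operator $\sigma$ on permutations of $[n]$ is defined by: (a) if $n$ is neither $a_1$ nor $a_n$, then $\sigma(a_1\cdots a_n)=b_1\cdots b_n$ with $b_i=a_i+1$, except that the entry $n+1$ is replaced by $1$ in its position; (b) if $a_n=n$, then $\sigma(a_1\cdots a_{n-1}n)=1\,b_1b_2\cdots b_{n-1}$ with $b_i=a_i+1$; (c) if $a_1=n$, then $\sigma(na_1\cdots a_{n-1})=b_1\cdots b_{n-1}\,1$ with $b_i=a_i+1$. For a permutation $\xi=a_1\cdots a_{n-1}n$ with last entry $n$ (called canonical), define $\tau\xi=\sigma^{\,n-a_{n-1}}\xi$ (the $(n-a_{n-1})$-fold application of $\sigma$); this is again canonical. The period of $\xi$ under $\sigma$ (resp. $\tau$) is the smallest positive integer $\ell$ with $\sigma^\ell\xi=\xi$ (resp. $\tau^\ell\xi=\xi$). *)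

theory Defs
  imports "HOL-Combinatorics.Combinatorics"
begin

text \<open>
  A permutation \<open>a\<^sub>1 \<dots> a\<^sub>n\<close> of \<open>{1..n}\<close> in one-line notation is a list in
  \<^term>\<open>permutations_of_set {1..n}\<close>; list positions count from \<open>0\<close>, so \<open>a\<^sub>i\<close> is \<open>xs ! (i - 1)\<close>.
\<close>

definition parity_alternating :: "nat list \<Rightarrow> bool" where
  "parity_alternating xs \<longleftrightarrow>
     (\<forall>i. Suc i < length xs \<longrightarrow> even (xs ! i) \<noteq> even (xs ! Suc i))"

definition ascents :: "nat list \<Rightarrow> nat set" where
  "ascents xs = {i. Suc i < length xs \<and> xs ! i < xs ! Suc i}"

definition sigma :: "nat list \<Rightarrow> nat list" where
  "sigma xs =
     (let n = length xs in
      if last xs = n then 1 # map (\<lambda>a. a + 1) (butlast xs)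
      else if hd xs = n then map (\<lambda>a. a + 1) (tl xs) @ [1]
      else map (\<lambda>a. if a = n then 1 else a + 1) xs)"

text \<open>
  Meaningful on permutations of \<open>{1..n}\<close> with \<open>n \<ge> 2\<close> and last entry \<open>n\<close>;
  \<open>xs ! (n - 2)\<close> is the entry \<open>a\<close> at (one-based) position \<open>n - 1\<close>.
\<close>

definition tau :: "nat list \<Rightarrow> nat list" where
  "tau xs = (let n = length xs in (sigma ^^ (n - xs ! (n - 2))) xs)"

text \<open>
  The period of \<open>xs\<close> under \<open>f\<close>, the smallest positive \<open>l\<close> with \<open>(f ^^ l) xs = xs\<close>, is
  \<^term>\<open>least_power f xs\<close>.
\<close>

end

theory Submission
  imports Defs
begin

text \<open>
  Modulo \<open>n\<close>, the operator \<^const>\<open>tau\<close> rotates a canonical permutation one place to the right and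
  translates it so that its last entry is \<open>n\<close> again; hence the \<open>n\<close>-th power of \<^const>\<open>tau\<close>
  fixes it, and the exponents of \<^const>\<open>sigma\<close> used along the way are the cyclic differences
  of neighbouring entries, taken in \<open>{1..n-1}\<close>. These add up to \<open>n\<close> times the number \<open>n - k\<close> of
  cyclic descents, so on average one step of \<^const>\<open>tau\<close> takes \<open>n - k\<close> steps of \<^const>\<open>sigma\<close>.
  Since \<^const>\<open>tau\<close> is the first return map of \<^const>\<open>sigma\<close> to the canonical
  permutations, the period under \<^const>\<open>sigma\<close> is the sum of these exponents over one period
  under \<^const>\<open>tau\<close>.
\<close>

section \<open>First return maps\<close>

lemma funpow_return:
  assumes "\<And>x. P x \<Longrightarrow> g x = (f ^^ r x) x" and "\<And>x. P x \<Longrightarrow> P (g x)" and "P x"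
  shows "(g ^^ i) x = (f ^^ (\<Sum>j<i. r ((g ^^ j) x))) x \<and> P ((g ^^ i) x)"
proof (induction i)
  case 0
  then show ?case using assms(3) by simp
next
  case (Suc i)
  let ?y = "(g ^^ i) x"
  have "(g ^^ Suc i) x = (f ^^ r ?y) ?y"
    using conjunct2[OF Suc] assms(1)[of ?y] by simp
  also have "\<dots> = (f ^^ (r ?y + (\<Sum>j<i. r ((g ^^ j) x)))) x"
    using Suc by (metis comp_apply funpow_add)
  finally have "(g ^^ Suc i) x = (f ^^ (\<Sum>j<Suc i. r ((g ^^ j) x))) x"
    by (simp add: add.commute)
  then show ?case
    using conjunct2[OF Suc] assms(2)[of ?y] by simp
qed

text \<open>Strong induction on \<open>m\<close>: if \<open>m\<close> is positive, minimality of the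
  return time forces \<open>r x \<le> m\<close>, so one step of \<open>g\<close> splits off and the
  remaining \<open>m - r x\<close> steps start at \<open>g x\<close>, again in
  \<open>P\<close>.\<close>

lemma return_time_eq_sum:
  assumes "\<And>x. P x \<Longrightarrow> g x = (f ^^ r x) x" and "\<And>x. P x \<Longrightarrow> P (g x)"
    and "\<And>x. P x \<Longrightarrow> 0 < r x"
    and "\<And>x j. P x \<Longrightarrow> 0 < j \<Longrightarrow> j < r x \<Longrightarrow> \<not> P ((f ^^ j) x)"
    and "P x" and "P ((f ^^ m) x)"
  shows "\<exists>i. m = (\<Sum>j<i. r ((g ^^ j) x))"
  using assms(5,6)
proof (induction m arbitrary: x rule: less_induct)
  case (less m)
  show ?case
  proof (cases "m = 0")
    case True
    then show ?thesis by (intro exI[of _ 0]) simp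
  next
    case False
    then have le: "r x \<le> m"
      using assms(4)[OF less.prems(1), of m] less.prems(2) by linarith
    have "(f ^^ (m - r x)) (g x) = (f ^^ (m - r x + r x)) x"
      by (simp add: assms(1)[OF less.prems(1)] funpow_add del: le_add_diff_inverse2)
    then have "P ((f ^^ (m - r x)) (g x))"
      using le less.prems(2) by simp
    moreover have "m - r x < m"
      using False assms(3)[OF less.prems(1)] by simp
    ultimately obtain i where "m - r x = (\<Sum>j<i. r ((g ^^ j) (g x)))"
      using less.IH assms(2)[OF less.prems(1)] by blast
    then have "m = (\<Sum>j<Suc i. r ((g ^^ j) x))"
      using le by (simp add: sum.lessThan_Suc_shift funpow_Suc_right del: sum.lessThan_Suc funpow.simps(2))
    then show ?thesis by blast
  qed
qed

text \<open>A return of \<open>f\<close> to \<open>x\<close> is in particular a return to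
  \<open>P\<close>, so its time is a partial sum \<open>R i\<close> with
  \<open>(g ^^ i) x = x\<close>. Then \<open>i\<close> is at least the period of \<open>g\<close>,
  and \<open>R\<close> is monotone.\<close>

lemma least_power_first_return:
  fixes r :: "'a \<Rightarrow> nat"
  assumes g: "\<And>x. P x \<Longrightarrow> g x = (f ^^ r x) x" and Pg: "\<And>x. P x \<Longrightarrow> P (g x)"
    and r: "\<And>x. P x \<Longrightarrow> 0 < r x"
    and first: "\<And>x j. P x \<Longrightarrow> 0 < j \<Longrightarrow> j < r x \<Longrightarrow> \<not> P ((f ^^ j) x)"
    and "P x" and per: "(g ^^ m) x = x" "0 < m"
  shows "least_power f x = (\<Sum>j<least_power g x. r ((g ^^ j) x))"
proof -
  define l where "l = least_power g x"
  define R where "R i = (\<Sum>j<i. r ((g ^^ j) x))" for i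
  have l: "(g ^^ l) x = x" "0 < l"
    using least_powerI[OF per] by (simp_all add: l_def)
  have iter: "(g ^^ i) x = (f ^^ R i) x" "P ((g ^^ i) x)" for i
    unfolding R_def using funpow_return[of P g r f x i, OF g Pg \<open>P x\<close>] by blast+
  have mono: "R i \<le> R j" if "i \<le> j" for i j
    unfolding R_def using that by (intro sum_mono2) auto
  have "0 < R l"
    using mono[of 1 l] l(2) r[OF \<open>P x\<close>] by (simp add: R_def)
  moreover have "(f ^^ R l) x = x"
    using iter(1)[of l] l by simp
  moreover have "R l \<le> s" if s: "(f ^^ s) x = x" "0 < s" for s
  proof -
    obtain i where i: "s = R i"
      using return_time_eq_sum[of P g r f x s] g Pg r first \<open>P x\<close> s by (auto simp: R_def)
    then have "(g ^^ i) x = x" "0 < i"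
      using s iter(1)[of i] by (auto simp: R_def intro: Suc_lessI gr0I)
    then have "l \<le> i"
      unfolding l_def by (rule least_power_le)
    then show ?thesis
      using mono i by simp
  qed
  ultimately show ?thesis
    unfolding least_power_def[of f] R_def[symmetric] l_def[symmetric]
    by (intro Least_equality) auto
qed

text \<open>Used to recover the sum over one period from the sum over a multiple of it, the latter
  being the one that can be evaluated.\<close>

lemma sum_funpow_period:
  fixes r :: "'a \<Rightarrow> nat"
  assumes "(g ^^ l) x = x"
  shows "(\<Sum>j<q * l. r ((g ^^ j) x)) = q * (\<Sum>j<l. r ((g ^^ j) x))"
proof (induction q)
  case (Suc q)
  have *: "(g ^^ (q * l)) x = x"
    by (induction q) (simp_all add: funpow_add assms)
  have "(\<Sum>j<a + b. h j) = (\<Sum>j<a. h j) + (\<Sum>j<b. h (j + a))" for h :: "nat \<Rightarrow> nat" and a b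
    by (induction b) (simp_all add: add.commute)
  from this[of "\<lambda>j. r ((g ^^ j) x)" "q * l" l] show ?case
    using Suc * by (simp add: funpow_add add.commute)
qed simp

section \<open>Translation modulo n and canonical permutations\<close>

text \<open>Translation by \<open>j\<close> modulo \<open>n\<close> with representatives
  \<open>1..n\<close>, so that \<open>n\<close> stands for the zero class; hence the shift by one
  before and after the reduction.\<close>

definition cyc_add :: "nat \<Rightarrow> nat \<Rightarrow> nat \<Rightarrow> nat" where
  "cyc_add n j x = (x - 1 + j) mod n + 1"

lemma cyc_add_cyc_add: "cyc_add n i (cyc_add n j x) = cyc_add n (j + i) x"
  by (simp add: cyc_add_def mod_simps add.assoc)

lemma cyc_add_range: "0 < n \<Longrightarrow> cyc_add n j x \<in> {1..n}"
  by (simp add: cyc_add_def Suc_leI)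

lemma cyc_add_dvd: "n dvd j \<Longrightarrow> x \<in> {1..n} \<Longrightarrow> cyc_add n j x = x"
  unfolding cyc_add_def mod_add_right_eq[of "x - 1" j n, symmetric] by (auto simp: dvd_imp_mod_0)

text \<open>The inverse is translation by \<open>(n - 1) * j\<close>, a natural number congruent to
  \<open>-j\<close> modulo \<open>n\<close>.\<close>

lemma inj_on_cyc_add: "inj_on (cyc_add n j) {1..n}"
proof (rule inj_on_inverseI)
  fix x assume x: "x \<in> {1..n}"
  then have "j + (n - 1) * j = n * j"
    by (cases n) auto
  then have "n dvd j + (n - 1) * j"
    by simp
  then show "cyc_add n ((n - 1) * j) (cyc_add n j x) = x"
    using x by (simp add: cyc_add_cyc_add cyc_add_dvd)
qed

definition canonical :: "nat \<Rightarrow> nat list \<Rightarrow> bool" where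
  "canonical n xs \<longleftrightarrow> xs \<in> permutations_of_set {1..n} \<and> last xs = n"

lemma canonicalD:
  assumes "canonical n xs"
  shows "length xs = n" "set xs = {1..n}" "distinct xs" "last xs = n"
  using assms unfolding canonical_def
  by (auto simp: permutations_of_set_def dest: distinct_card)

lemma canonical_nth_range: "canonical n xs \<Longrightarrow> i < n \<Longrightarrow> 1 \<le> xs ! i \<and> xs ! i \<le> n"
  by (metis atLeastAtMost_iff canonicalD(1,2) nth_mem)

lemma canonical_last_nth: "canonical n xs \<Longrightarrow> 0 < n \<Longrightarrow> xs ! (n - 1) = n"
  using canonicalD(1,4) last_conv_nth by (metis length_greater_0_conv)

lemma canonical_penultimate:
  assumes "canonical n xs" "2 \<le> n"
  shows "1 \<le> xs ! (n - 2)" "xs ! (n - 2) < n"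
proof -
  have "xs ! (n - 2) \<noteq> xs ! (n - 1)"
    using canonicalD(1,3)[OF assms(1)] assms(2) by (simp add: nth_eq_iff_index_eq)
  then show "1 \<le> xs ! (n - 2)" "xs ! (n - 2) < n"
    using canonical_nth_range[OF assms(1), of "n - 2"] canonical_last_nth[OF assms(1)] assms(2)
    by auto
qed

lemma rotate_last: "xs \<noteq> [] \<Longrightarrow> rotate (length xs - 1) xs = last xs # butlast xs"
  using rotate_append[of "butlast xs" "[last xs]"] by simp

lemma last_rotate:
  assumes "2 \<le> length xs"
  shows "last (rotate (length xs - 1) xs) = xs ! (length xs - 2)"
  using assms by (subst last_conv_nth) (auto simp: nth_rotate mod_if)

section \<open>The action of sigma and tau\<close>

text \<open>The first application of \<open>sigma\<close> moves the last entry to the front. After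
  \<open>j\<close> steps the first entry is \<open>j\<close> and the last is
  \<open>xs ! (n - 2) + j\<close>; while both are below \<open>n\<close>, the next step is the
  generic case, a mere translation by one.\<close>

lemma funpow_sigma_canonical:
  assumes c: "canonical n xs" "2 \<le> n" and "0 < j" "j \<le> n - xs ! (n - 2)"
  shows "(sigma ^^ j) xs = map (cyc_add n j) (rotate (n - 1) xs)"
  using assms(3,4)
proof (induction j rule: nat_induct_non_zero)
  case 1
  have ne: "xs \<noteq> []" using canonicalD(1)[OF c(1)] c(2) by auto
  have *: "cyc_add n 1 a = a + 1" if "a \<in> set (butlast xs)" for a
  proof -
    have "distinct (butlast xs @ [last xs])"
      using ne canonicalD(3)[OF c(1)] by simp
    then have "a \<noteq> n" using that canonicalD(4)[OF c(1)] by auto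
    moreover have "a \<in> {1..n}"
      using that in_set_butlastD[of a xs] canonicalD(2)[OF c(1)] by auto
    ultimately show ?thesis by (simp add: cyc_add_def)
  qed
  have "cyc_add n 1 n = 1" using c(2) by (simp add: cyc_add_def)
  then show ?case
    using * ne rotate_last[OF ne] canonicalD(1,4)[OF c(1)] by (simp add: sigma_def)
next
  case (Suc j)
  let ?ys = "map (cyc_add n j) (rotate (n - 1) xs)"
  have len: "length ?ys = n" using canonicalD(1)[OF c(1)] by simp
  have ne: "xs \<noteq> []" "?ys \<noteq> []" using canonicalD(1)[OF c(1)] c(2) by auto
  have jn: "j < n - xs ! (n - 2)" using Suc by simp
  note pen = canonical_penultimate[OF c]
  have "last ?ys = cyc_add n j (xs ! (n - 2))"
    using ne last_rotate[of xs] canonicalD(1)[OF c(1)] c(2) by (simp add: last_map)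
  also have "\<dots> = xs ! (n - 2) + j"
    using pen jn by (simp add: cyc_add_def)
  finally have last: "last ?ys \<noteq> n" using jn by simp
  have "hd ?ys = cyc_add n j n"
    using rotate_last[OF ne(1)] canonicalD(1,4)[OF c(1)] by simp
  also have "\<dots> = j"
    using Suc.hyps jn pen by (cases j) (auto simp: cyc_add_def)
  finally have hd: "hd ?ys \<noteq> n" using jn by simp
  have "(if cyc_add n j a = n then 1 else cyc_add n j a + 1) = cyc_add n (Suc j) a" for a
    using mod_Suc[of "a - 1 + j" n] by (simp add: cyc_add_def)
  then have "sigma ?ys = map (cyc_add n (Suc j)) (rotate (n - 1) xs)"
    using last hd len by (simp add: sigma_def Let_def)
  then show ?case using Suc by simp
qed

lemma tau_eq_funpow_sigma:
  "canonical n xs \<Longrightarrow> tau xs = (sigma ^^ (n - xs ! (n - 2))) xs"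
  using canonicalD(1) by (simp add: tau_def)

lemma tau_canonical:
  assumes "canonical n xs" "2 \<le> n"
  shows "tau xs = map (cyc_add n (n - xs ! (n - 2))) (rotate (n - 1) xs)"
  using funpow_sigma_canonical[OF assms] canonical_penultimate[OF assms]
  by (simp add: tau_eq_funpow_sigma[OF assms(1)])

text \<open>Shows at once that \<open>tau\<close> leads back to last entry \<open>n\<close> and that
  no smaller positive power of \<open>sigma\<close> does.\<close>

lemma last_funpow_sigma:
  assumes c: "canonical n xs" "2 \<le> n" and j: "0 < j" "j \<le> n - xs ! (n - 2)"
  shows "last ((sigma ^^ j) xs) = xs ! (n - 2) + j"
proof -
  have "rotate (n - 1) xs \<noteq> []" using canonicalD(1)[OF c(1)] c(2) by auto
  moreover have "last (rotate (n - 1) xs) = xs ! (n - 2)"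
    using last_rotate[of xs] canonicalD(1)[OF c(1)] c(2) by auto
  ultimately show ?thesis
    using canonical_penultimate[OF c] j
    by (simp add: funpow_sigma_canonical[OF c j] last_map cyc_add_def)
qed

lemma canonical_tau:
  assumes c: "canonical n xs" "2 \<le> n"
  shows "canonical n (tau xs)"
proof -
  let ?ys = "tau xs"
  have inj: "inj_on (cyc_add n (n - xs ! (n - 2))) (set (rotate (n - 1) xs))"
    using inj_on_cyc_add canonicalD(2)[OF c(1)] by simp
  then have d: "distinct ?ys"
    using canonicalD(3)[OF c(1)] by (simp add: tau_canonical[OF c] distinct_map)
  have "set ?ys \<subseteq> {1..n}"
    using cyc_add_range c(2) by (auto simp: tau_canonical[OF c])
  moreover have "card (set ?ys) = card {1..n}"
    using distinct_card[OF d] canonicalD(1)[OF c(1)] by (simp add: tau_canonical[OF c])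
  ultimately have "set ?ys = {1..n}"
    by (intro card_subset_eq) auto
  moreover have "last ?ys = n"
    using last_funpow_sigma[OF c] canonical_penultimate[OF c]
    by (simp add: tau_eq_funpow_sigma[OF c(1)])
  ultimately show ?thesis
    using d by (simp add: canonical_def permutations_of_set_def)
qed

lemma canonical_funpow_tau:
  "canonical n xs \<Longrightarrow> 2 \<le> n \<Longrightarrow> canonical n ((tau ^^ i) xs)"
  by (induction i) (auto intro: canonical_tau)

section \<open>Powers of \<open>tau\<close>, their total \<open>sigma\<close> exponents and the two
  periods\<close>

definition sigma_steps :: "nat \<Rightarrow> nat list \<Rightarrow> nat" where
  "sigma_steps i xs = (\<Sum>j<i. length xs - (tau ^^ j) xs ! (length xs - 2))"

text \<open>Rotating positions commutes with translating values, so the two amounts accumulate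
  separately.\<close>

lemma funpow_tau_canonical:
  assumes c: "canonical n xs" "2 \<le> n"
  shows "(tau ^^ i) xs = map (cyc_add n (sigma_steps i xs)) (rotate (i * (n - 1)) xs)"
proof (induction i)
  case 0
  show ?case
    using canonicalD(2)[OF c(1)] by (auto simp: sigma_steps_def cyc_add_dvd intro!: map_idI[symmetric])
next
  case (Suc i)
  have "(tau ^^ Suc i) xs = map (cyc_add n (n - (tau ^^ i) xs ! (n - 2)))
      (rotate (n - 1) (map (cyc_add n (sigma_steps i xs)) (rotate (i * (n - 1)) xs)))"
    using tau_canonical[OF canonical_funpow_tau[OF c, of i] c(2)]
    by (simp only: funpow.simps comp_apply flip: Suc)
  also have "\<dots> = map (cyc_add n (sigma_steps (Suc i) xs)) (rotate (Suc i * (n - 1)) xs)"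
    using canonicalD(1)[OF c(1)]
    by (simp add: rotate_map rotate_rotate comp_def cyc_add_cyc_add sigma_steps_def del: rotate_Suc)
  finally show ?case .
qed

text \<open>The total rotation is by a multiple of \<open>n\<close>, which leaves a pure
  translation. Powers of \<open>tau\<close> stay canonical, so it fixes the last entry
  \<open>n\<close> and its amount is divisible by \<open>n\<close>.\<close>

lemma funpow_tau_length:
  assumes c: "canonical n xs" "2 \<le> n"
  shows "(tau ^^ n) xs = xs"
proof -
  let ?R = "sigma_steps n xs"
  have "rotate (n * (n - 1)) xs = xs"
    using canonicalD(1)[OF c(1)] by (simp add: rotate_id)
  then have eq: "(tau ^^ n) xs = map (cyc_add n ?R) xs"
    using funpow_tau_canonical[OF c, of n] by simp
  have "xs \<noteq> []" using canonicalD(1)[OF c(1)] c(2) by auto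
  then have "cyc_add n ?R n = n"
    using canonicalD(4)[OF canonical_funpow_tau[OF c, of n]] canonicalD(4)[OF c(1)]
    by (simp add: eq last_map)
  then have "Suc (n - 1 + ?R) mod n = 0"
    using mod_Suc[of "n - 1 + ?R" n] by (simp only: cyc_add_def Suc_eq_plus1 if_True simp_thms)
  moreover have "Suc (n - 1 + ?R) = ?R + n"
    using c(2) by simp
  ultimately have "n dvd ?R"
    by (simp add: mod_eq_0_iff_dvd)
  then show ?thesis
    using canonicalD(2)[OF c(1)] by (auto simp: eq cyc_add_dvd intro: map_idI)
qed

text \<open>Both \<open>n - cyc_add n R z\<close> and \<open>y - z\<close> represent the same class
  modulo \<open>n\<close>. The former lies in \<open>1..n-1\<close> and the latter strictly between
  \<open>-n\<close> and \<open>n\<close>, so their difference is \<open>0\<close> or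
  \<open>n\<close>, decided by the sign of \<open>y - z\<close>.\<close>

lemma cyc_add_difference:
  assumes "y \<in> {1..n}" "z \<in> {1..n}" "cyc_add n R y = n" "cyc_add n R z < n"
  shows "int (n - cyc_add n R z) = int y - int z + int n * of_bool (y \<le> z)"
proof -
  define a where "a = cyc_add n R z"
  define t where "t = (int y - int z - int (n - a)) div int n"
  have "int (y - 1 + R) = int y - 1 + int R" "int (z - 1 + R) = int z - 1 + int R"
    using assms(1,2) by auto
  moreover have "int ((y - 1 + R) mod n) = int n - 1" "int ((z - 1 + R) mod n) = int a - 1"
    using assms(3) unfolding a_def cyc_add_def by linarith+
  ultimately have y: "(int y - 1 + int R) mod int n = int n - 1"
    and z: "(int z - 1 + int R) mod int n = int a - 1"
    by (simp_all only: zmod_int)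
  have "((int y - 1 + int R) - (int z - 1 + int R)) mod int n
      = ((int n - 1) - (int a - 1)) mod int n"
    using y z by (metis mod_diff_eq)
  then have "int n dvd (int y - 1 + int R) - (int z - 1 + int R) - (int n - 1 - (int a - 1))"
    by (simp only: mod_eq_dvd_iff)
  then have "int n dvd int y - int z - int (n - a)"
    using assms(4) by (simp add: a_def of_nat_diff)
  then have t: "int y - int z - int (n - a) = int n * t"
    by (simp add: t_def)
  have a: "1 \<le> a" "a < n" using assms(4) by (simp_all add: a_def cyc_add_def)
  have "int n * t < int n * 1" "int n * (- 2) < int n * t"
    using assms(1,2) a unfolding t[symmetric] by (auto simp: of_nat_diff)
  then have "t < 1" "- 2 < t"
    using a by (simp_all only: mult_less_cancel_left_pos of_nat_0_less_iff)
  then have "t = 0 \<or> t = - 1" by linarith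
  then show ?thesis
    using t a assms(1,2) unfolding a_def[symmetric] by auto
qed

text \<open>Over \<open>n\<close> steps of \<open>tau\<close> the last two places, traced back to
  \<open>xs\<close>, run through all cyclically adjacent pairs. The differences telescope to zero
  around the cycle, and the correction \<open>n\<close> is counted once for each cyclic
  descent.\<close>

lemma sigma_steps_length:
  assumes c: "canonical n xs" "2 \<le> n"
  shows "sigma_steps n xs = n * (n - card (ascents xs))"
proof -
  obtain m where m: "n = Suc m" using c(2) by (cases n) auto
  note len = canonicalD(1)[OF c(1)]
  \<comment> \<open>Here \<open>p\<close> and \<open>q\<close> are the positions in
    \<open>xs\<close> from which the last and the penultimate entry of \<open>(tau ^^ j) xs\<close>
    originate.\<close>
  have step: "int (n - (tau ^^ j) xs ! (n - 2)) = int (xs ! p) - int (xs ! q)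
      + int n * of_bool (xs ! p \<le> xs ! q)"
    if "(j * (n - 1) + (n - 1)) mod n = p" "(j * (n - 1) + (n - 2)) mod n = q" for j p q
  proof -
    let ?R = "sigma_steps j xs"
    have nth: "(tau ^^ j) xs ! i = cyc_add n ?R (xs ! ((j * (n - 1) + i) mod n))" if "i < n" for i
      using that len by (simp add: funpow_tau_canonical[OF c] nth_rotate)
    have pq: "p < n" "q < n" using that c(2) by auto
    show ?thesis
      using cyc_add_difference[of "xs ! p" n "xs ! q" ?R] canonical_nth_range[OF c(1)] pq
        nth[of "n - 1"] nth[of "n - 2"] that c(2)
        canonical_last_nth[OF canonical_funpow_tau[OF c, of j]]
        canonical_penultimate[OF canonical_funpow_tau[OF c, of j]]
      by simp
  qed
  let ?h = "\<lambda>i. (int (xs ! Suc i) - int (xs ! i)) + int n * of_bool (xs ! Suc i \<le> xs ! i)"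
  \<comment> \<open>Each rotation by \<open>n - 1\<close> moves the traced pair one place to the
    left, starting from the positions \<open>m - 1\<close> and \<open>m\<close>.\<close>
  have inner: "int (n - (tau ^^ j) xs ! (n - 2)) = ?h (m - Suc j)" if "j < m" for j
  proof (rule step)
    have "j * (n - 1) + (n - 1) = Suc (m - Suc j) + j * n"
      using that m by (simp add: algebra_simps)
    then have "(j * (n - 1) + (n - 1)) mod n = Suc (m - Suc j) mod n"
      by (metis mod_mult_self1)
    then show "(j * (n - 1) + (n - 1)) mod n = Suc (m - Suc j)"
      using that m by simp
    have "j * (n - 1) + (n - 2) = (m - Suc j) + j * n"
      using that m by (simp add: algebra_simps)
    then have "(j * (n - 1) + (n - 2)) mod n = (m - Suc j) mod n"
      by (metis mod_mult_self1)
    then show "(j * (n - 1) + (n - 2)) mod n = m - Suc j"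
      using that m by simp
  qed
  \<comment> \<open>The remaining pair wraps around from the last entry \<open>n\<close> to the
    first entry. It is always a cyclic descent, which turns \<open>n - 1 - k\<close> linear descents
    into \<open>n - k\<close>, with \<open>k\<close> the number of ascents.\<close>
  have "int (n - (tau ^^ m) xs ! (n - 2))
      = int (xs ! 0) - int (xs ! m) + int n * of_bool (xs ! 0 \<le> xs ! m)"
  proof (rule step)
    have "m * (n - 1) + (n - 1) = m * n" using m by simp
    then show "(m * (n - 1) + (n - 1)) mod n = 0" by simp
    have "m * (n - 1) + (n - 2) = m + (m - 1) * n"
      using m c(2) by (cases m) (simp_all add: algebra_simps)
    then have "(m * (n - 1) + (n - 2)) mod n = m mod n"
      by (metis mod_mult_self1)
    then show "(m * (n - 1) + (n - 2)) mod n = m"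
      using m by simp
  qed
  moreover have "xs ! 0 \<le> xs ! m"
    using canonical_last_nth[OF c(1)] canonical_nth_range[OF c(1), of 0] m by simp
  ultimately have outer: "int (n - (tau ^^ m) xs ! (n - 2)) = int (xs ! 0) - int (xs ! m) + int n"
    by simp
  have desc: "(\<Sum>i<m. of_bool (xs ! Suc i \<le> xs ! i)) = int m - int (card (ascents xs))"
  proof -
    have asc: "ascents xs = {..<m} \<inter> {i. xs ! i < xs ! Suc i}"
      using len m by (auto simp: ascents_def)
    have "(\<Sum>i<m. of_bool (xs ! Suc i \<le> xs ! i))
        = (\<Sum>i<m. (1::int) - of_bool (xs ! i < xs ! Suc i))"
      by (intro sum.cong) auto
    also have "\<dots> = int m - int (card (ascents xs))"
      by (simp add: sum_subtractf asc)
    finally show ?thesis .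
  qed
  have "int (sigma_steps n xs)
      = (\<Sum>j<m. ?h (m - Suc j)) + (int (xs ! 0) - int (xs ! m) + int n)"
    unfolding sigma_steps_def len using inner outer by (simp add: m)
  also have "(\<Sum>j<m. ?h (m - Suc j)) = (\<Sum>i<m. ?h i)"
    by (rule sum.nat_diff_reindex)
  also have "\<dots> = int (xs ! m) - int (xs ! 0) + int n * (int m - int (card (ascents xs)))"
    using sum_lessThan_telescope[of "\<lambda>i. int (xs ! i)" m]
    by (simp add: sum.distrib desc flip: sum_distrib_left)
  finally have "int (sigma_steps n xs) = int n * (int n - int (card (ascents xs)))"
    by (simp add: m algebra_simps)
  moreover have "card (ascents xs) \<le> n"
    using len by (intro card_mono[of "{..<n}", simplified]) (auto simp: ascents_def)
  ultimately show ?thesis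
    by (metis of_nat_diff of_nat_eq_iff of_nat_mult)
qed

text \<open>The period of \<open>tau\<close> divides \<open>n\<close>, so the total over
  \<open>n\<close> steps is \<open>q\<close> times the total over one period; cancelling
  \<open>q\<close> evaluates the latter, which is the period of \<open>sigma\<close> by the first
  return property.\<close>

lemma least_power_sigma_eq:
  assumes c: "canonical n xs" "2 \<le> n"
  shows "least_power sigma xs = least_power tau xs * (n - card (ascents xs))"
proof -
  let ?l = "least_power tau xs" and ?r = "\<lambda>xs::nat list. n - xs ! (n - 2)"
  note len = canonicalD(1)[OF c(1)]
  have per: "(tau ^^ n) xs = xs" "0 < n" using funpow_tau_length[OF c] c(2) by auto
  have l: "(tau ^^ ?l) xs = xs" "?l dvd n"
    using least_powerI[OF per] least_power_minimal[of n tau xs] per by auto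
  then obtain q where q: "n = q * ?l" using dvd_div_mult_self by metis
  have "q * sigma_steps ?l xs = q * (?l * (n - card (ascents xs)))"
    using sum_funpow_period[OF l(1), of ?r q] sigma_steps_length[OF c] q len
    by (simp add: sigma_steps_def mult.assoc)
  then have "sigma_steps ?l xs = ?l * (n - card (ascents xs))"
    using q c(2) by auto
  moreover have "least_power sigma xs = sigma_steps ?l xs"
    unfolding sigma_steps_def len
  proof (rule least_power_first_return[where P = "canonical n" and r = ?r])
    show "\<not> canonical n ((sigma ^^ j) ys)" if "canonical n ys" "0 < j" "j < ?r ys" for ys j
      using that last_funpow_sigma[OF that(1) c(2), of j] canonicalD(4) by fastforce
  qed (use c per tau_eq_funpow_sigma canonical_tau canonical_penultimate in auto)
  ultimately show ?thesis by simp
qed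

theorem theorem6:
  fixes n k d :: nat and \<xi> :: "nat list"
  assumes "even n" and "n > 0"
    and "k \<le> n - 1"
    and "\<xi> \<in> permutations_of_set {1..n}"
    and "parity_alternating \<xi>"
    and "card (ascents \<xi>) = k"
    and "last \<xi> = n"
    and "d > 0"
  shows "least_power tau \<xi> = d \<longleftrightarrow> least_power sigma \<xi> = d * (n - k)"
proof -
  \<comment> \<open>Parity and positivity give \<open>2 \<le> n\<close>; the positive factor
    \<open>n - k\<close> can be cancelled in the converse direction.\<close>
  have "2 \<le> n" "0 < n - k"
    using assms(1-3) by (auto elim: evenE)
  then show ?thesis
    using least_power_sigma_eq[of n \<xi>] assms(4,6,7) by (simp add: canonical_def)
qed

end
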